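(* For the class of network contribution games with concave reward functions $f_e$ for all $e\in E$ that have a pairwise equilibrium, the price of anarchy for pairwise equilibria is at most $2$.
   Context: Network contribution game: a finite simple undirected graph $G=(V,E)$; every node $v\in V$ is a player with budget $B_v\ge 0$. Let $E_v$ be the set of edges incident to $v$. A strategy of $v$ is a function $s_v:E_v\to\mathbb{R}_{\ge 0}$ with $\sum_{e\in E_v}s_v(e)\le B_v$; a state $s=(s_v)_{v\in V}$ consists of one strategy per player. Each edge $e=(u,v)$ has a reward function $f_e:\mathbb{R}_{\ge 0}^2\to\mathbb{R}_{\ge 0}$ that is nondecreasing in each argument, symmetric, continuous and differentiable. The utility of $v$ is $w_v(s)=\sum_{e=(v,u)\in E_v}f_e(s_v(e),s_u(e))$, and the social welfare is $w(s)=\sum_{v\in V}w_v(s)$. A social optimum $s^*$ is a state maximizing $w$. A state $s$ is a (pure) Nash equilibrium if $w_v(s)\ge w_v(s_v',s_{-v})$ for every player $v$ and every strategy $s_v'$. An improving bilateral deviation in $s$ is a pair of strategies $(s_u',s_v')$ of two players $u\neq v$ with $w_u(s_u',s_v',s_{-u,v})>w_u(s)$ and $w_v(s_u',s_v',s_{-u,v})>w_v(s)$. A pairwise equilibrium is a Nash equilibrium that admits no improving bilateral deviation. For a game with pairwise equilibria, the price of anarchy for pairwise equilibria is the ratio $w(s^* )/w(s)$ for the pairwise equilibrium $s$ of worst (smallest) welfare. For a class of games it is the worst (supremum) value over all games in the class that have pairwise equilibria. *)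

theory Defs
  imports "HOL-Analysis.Analysis"
begin

text \<open>
  Edges are two-element vertex sets. The symmetric reward function of \<open>e = {u, v}\<close> is
  curried; only its values at nonnegative arguments are relevant.
\<close>

record 'v contribution_game =
  verts :: "'v set"
  edges :: "'v set set"
  budget :: "'v \<Rightarrow> real"
  reward :: "'v set \<Rightarrow> real \<Rightarrow> real \<Rightarrow> real"

definition reward_function :: "(real \<Rightarrow> real \<Rightarrow> real) \<Rightarrow> bool" where
  "reward_function f \<longleftrightarrow>
     (\<forall>x\<ge>0. \<forall>y\<ge>0. 0 \<le> f x y) \<and>
     (\<forall>y\<ge>0. mono_on {0..} (\<lambda>x. f x y)) \<and>
     (\<forall>x\<ge>0. mono_on {0..} (\<lambda>y. f x y)) \<and>
     (\<forall>x\<ge>0. \<forall>y\<ge>0. f x y = f y x) \<and>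
     continuous_on ({0..} \<times> {0..}) (\<lambda>(x, y). f x y) \<and>
     (\<lambda>(x, y). f x y) differentiable_on ({0..} \<times> {0..})"

definition network_contribution_game :: "'v contribution_game \<Rightarrow> bool" where
  "network_contribution_game G \<longleftrightarrow>
     finite (verts G) \<and>
     (\<forall>e\<in>edges G. e \<subseteq> verts G \<and> card e = 2) \<and>
     (\<forall>v\<in>verts G. 0 \<le> budget G v) \<and>
     (\<forall>e\<in>edges G. reward_function (reward G e))"

text \<open>Joint concavity in the pair of contributions, not concavity in each coordinate separately.\<close>

definition concave_rewards :: "'v contribution_game \<Rightarrow> bool" where
  "concave_rewards G \<longleftrightarrow>
     (\<forall>e\<in>edges G. concave_on ({0..} \<times> {0..}) (\<lambda>(x, y). reward G e x y))"

definition incident :: "'v contribution_game \<Rightarrow> 'v \<Rightarrow> 'v set set" where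
  "incident G v = {e \<in> edges G. v \<in> e}"

definition strategies :: "'v contribution_game \<Rightarrow> 'v \<Rightarrow> ('v set \<Rightarrow> real) set" where
  "strategies G v =
     {x \<in> incident G v \<rightarrow>\<^sub>E {0..}. (\<Sum>e\<in>incident G v. x e) \<le> budget G v}"

definition states :: "'v contribution_game \<Rightarrow> ('v \<Rightarrow> 'v set \<Rightarrow> real) set" where
  "states G = (\<Pi>\<^sub>E v\<in>verts G. strategies G v)"

text \<open>Summing over the neighbours \<open>u\<close> of \<open>v\<close> is summing over the edges \<open>{v, u}\<close> incident to \<open>v\<close>.\<close>

definition utility :: "'v contribution_game \<Rightarrow> ('v \<Rightarrow> 'v set \<Rightarrow> real) \<Rightarrow> 'v \<Rightarrow> real" where
  "utility G s v =
     (\<Sum>u\<in>{u \<in> verts G. {v, u} \<in> edges G}. reward G {v, u} (s v {v, u}) (s u {v, u}))"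

definition social_welfare :: "'v contribution_game \<Rightarrow> ('v \<Rightarrow> 'v set \<Rightarrow> real) \<Rightarrow> real" where
  "social_welfare G s = (\<Sum>v\<in>verts G. utility G s v)"

definition social_optimum :: "'v contribution_game \<Rightarrow> ('v \<Rightarrow> 'v set \<Rightarrow> real) \<Rightarrow> bool" where
  "social_optimum G s \<longleftrightarrow>
     s \<in> states G \<and> (\<forall>t\<in>states G. social_welfare G t \<le> social_welfare G s)"

definition nash_equilibrium :: "'v contribution_game \<Rightarrow> ('v \<Rightarrow> 'v set \<Rightarrow> real) \<Rightarrow> bool" where
  "nash_equilibrium G s \<longleftrightarrow>
     s \<in> states G \<and>
     (\<forall>v\<in>verts G. \<forall>x\<in>strategies G v. utility G (s(v := x)) v \<le> utility G s v)"

definition improving_bilateral_deviation ::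
  "'v contribution_game \<Rightarrow> ('v \<Rightarrow> 'v set \<Rightarrow> real) \<Rightarrow>
   'v \<Rightarrow> 'v \<Rightarrow> ('v set \<Rightarrow> real) \<Rightarrow> ('v set \<Rightarrow> real) \<Rightarrow> bool" where
  "improving_bilateral_deviation G s u v x y \<longleftrightarrow>
     u \<in> verts G \<and> v \<in> verts G \<and> u \<noteq> v \<and>
     x \<in> strategies G u \<and> y \<in> strategies G v \<and>
     utility G (s(u := x, v := y)) u > utility G s u \<and>
     utility G (s(u := x, v := y)) v > utility G s v"

definition pairwise_equilibrium :: "'v contribution_game \<Rightarrow> ('v \<Rightarrow> 'v set \<Rightarrow> real) \<Rightarrow> bool" where
  "pairwise_equilibrium G s \<longleftrightarrow>
     nash_equilibrium G s \<and> \<not> (\<exists>u v x y. improving_bilateral_deviation G s u v x y)"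

text \<open>
  Convention for zero denominators: \<open>0/0 = 1\<close>, and \<open>a/0 = \<infinity>\<close> for \<open>a > 0\<close> (the latter is
  already the behaviour of division on \<^typ>\<open>ereal\<close>).
\<close>

definition welfare_ratio :: "real \<Rightarrow> real \<Rightarrow> ereal" where
  "welfare_ratio a b = (if a = 0 \<and> b = 0 then 1 else ereal a / ereal b)"

text \<open>
  The welfare of a social optimum is unique and the ratio is antitone in the welfare of the
  equilibrium, so the supremum below is the ratio for the worst pairwise equilibrium. That
  the supremum does not range over an empty set of optima is \<open>social_optimum_exists\<close>.
\<close>

definition pairwise_price_of_anarchy :: "'v contribution_game \<Rightarrow> ereal" where
  "pairwise_price_of_anarchy G =
     Sup {welfare_ratio (social_welfare G opt) (social_welfare G s) | opt s.
            social_optimum G opt \<and> pairwise_equilibrium G s}"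

definition class_pairwise_price_of_anarchy :: "'v contribution_game set \<Rightarrow> ereal" where
  "class_pairwise_price_of_anarchy C =
     (SUP G \<in> {G \<in> C. \<exists>s. pairwise_equilibrium G s}. pairwise_price_of_anarchy G)"

lemma compact_PiE_fun:
  fixes S :: "'i \<Rightarrow> 'a::topological_space set"
  assumes "\<And>i. i \<in> I \<Longrightarrow> compact (S i)"
  shows "compact (PiE I S)"
proof -
  have "compactin euclidean (PiE UNIV (\<lambda>i. if i \<in> I then S i else {undefined}))"
    using assms by (subst euclidean_product_topology[symmetric])
      (simp add: compactin_PiE)
  moreover have "PiE UNIV (\<lambda>i. if i \<in> I then S i else {undefined}) = PiE I S"
    by (auto simp: PiE_def Pi_def extensional_def split: if_splits)
  ultimately show ?thesis by simp
qed

lemma finite_incident: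
  assumes "network_contribution_game G"
  shows "finite (incident G v)"
proof (rule finite_subset)
  show "incident G v \<subseteq> Pow (verts G)"
    using assms by (auto simp: network_contribution_game_def incident_def)
qed (use assms in \<open>auto simp: network_contribution_game_def\<close>)

lemma compact_strategies:
  assumes "network_contribution_game G"
  shows "compact (strategies G v)"
proof -
  let ?E = "incident G v" and ?B = "budget G v"
  have le: "x e \<le> (\<Sum>e\<in>?E. x e)" if "x \<in> ?E \<rightarrow>\<^sub>E {0..}" "e \<in> ?E" for x :: "'a set \<Rightarrow> real" and e
    using that finite_incident[OF assms] by (intro member_le_sum) auto
  have "strategies G v =
      (?E \<rightarrow>\<^sub>E {0..?B}) \<inter> {x. (\<Sum>e\<in>?E. x e) \<le> ?B}"
  proof (intro set_eqI iffI)
    fix x assume x: "x \<in> strategies G v"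
    then have "x e \<le> ?B" if "e \<in> ?E" for e
      using le[of x e] that by (force simp: strategies_def)
    then show "x \<in> (?E \<rightarrow>\<^sub>E {0..?B}) \<inter> {x. (\<Sum>e\<in>?E. x e) \<le> ?B}"
      using x by (auto simp: strategies_def PiE_iff)
  qed (auto simp: strategies_def PiE_iff)
  moreover have "closed {x :: 'a set \<Rightarrow> real. (\<Sum>e\<in>?E. x e) \<le> ?B}"
    by (intro closed_Collect_le continuous_intros) simp
  moreover have "compact (?E \<rightarrow>\<^sub>E {0..?B})"
    by (intro compact_PiE_fun) simp
  ultimately show ?thesis by (simp add: compact_Int_closed)
qed

lemma continuous_on_social_welfare:
  assumes G: "network_contribution_game G"
  shows "continuous_on (states G) (social_welfare G)"
  unfolding social_welfare_def utility_def
proof (intro continuous_on_sum)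
  fix v u assume v: "v \<in> verts G" and u: "u \<in> {u \<in> verts G. {v, u} \<in> edges G}"
  let ?e = "{v, u}"
  have "continuous_on ({0..} \<times> {0..}) (\<lambda>(x, y). reward G ?e x y)"
    using G u by (auto simp: network_contribution_game_def reward_function_def)
  moreover have "continuous_on (states G) (\<lambda>s. (s v ?e, s u ?e))"
  proof -
    have "continuous_on UNIV (\<lambda>s :: 'a \<Rightarrow> 'a set \<Rightarrow> real. s w e)" for w e
      by (rule continuous_on_product_then_coordinatewise[OF continuous_on_product_coordinates])
    then show ?thesis
      by (intro continuous_on_Pair) (auto intro: continuous_on_subset)
  qed
  moreover have "(\<lambda>s. (s v ?e, s u ?e)) ` states G \<subseteq> {0..} \<times> {0..}"
    using u v by (fastforce simp: states_def strategies_def incident_def PiE_iff)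
  ultimately have "continuous_on (states G) ((\<lambda>(x, y). reward G ?e x y) \<circ> (\<lambda>s. (s v ?e, s u ?e)))"
    by (meson continuous_on_compose continuous_on_subset)
  then show "continuous_on (states G) (\<lambda>s. reward G ?e (s v ?e) (s u ?e))"
    by (simp add: o_def)
qed

lemma states_nonempty:
  assumes "network_contribution_game G"
  shows "states G \<noteq> {}"
proof -
  have "restrict (\<lambda>v. restrict (\<lambda>_. 0) (incident G v)) (verts G) \<in> states G"
    using assms by (auto simp: states_def strategies_def network_contribution_game_def)
  then show ?thesis by blast
qed

lemma social_optimum_exists:
  assumes "network_contribution_game G"
  shows "\<exists>s. social_optimum G s"
proof -
  have "compact (states G)"
    unfolding states_def by (intro compact_PiE_fun compact_strategies assms)
  from continuous_attains_sup[OF this states_nonempty[OF assms]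
      continuous_on_social_welfare[OF assms]]
  show ?thesis by (auto simp: social_optimum_def)
qed

end

theory Submission
  imports Defs
begin

text \<open>
  Let \<open>s\<close> be a pairwise equilibrium and \<open>t\<close> an optimum. Since \<open>s\<close> is a Nash equilibrium, every
  player \<open>v\<close> has a multiplier \<open>\<lambda>\<^sub>v \<ge> 0\<close> bounding all marginal rewards of \<open>v\<close>, with equality on
  the edges that \<open>v\<close> contributes to. For every edge \<open>e\<close>, stability against bilateral deviations
  from \<open>s(e)\<close> in the direction of \<open>t(e)\<close> gives an endpoint \<open>v\<close> for which the linearised gain on
  \<open>e\<close> is at most \<open>\<lambda>\<^sub>v (t\<^sub>v(e) - s\<^sub>v(e))\<close>, and by concavity so is the gain \<open>f\<^sub>e(t) - f\<^sub>e(s)\<close>.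
  Charge \<open>e\<close> to that endpoint. When this is summed over the edges charged to \<open>v\<close>, the budget that
  \<open>v\<close> spends in \<open>s\<close> on any other edge \<open>e'\<close> is paid for by the reward of \<open>e'\<close>, because
  \<open>\<lambda>\<^sub>v s\<^sub>v(e')\<close> is at most this reward by concavity. So the edges charged to \<open>v\<close> have in \<open>t\<close> a
  total reward of at most \<open>w\<^sub>v(s)\<close>, and each edge counts twice in the welfare of \<open>t\<close>.
\<close>

section \<open>Differentiable concave functions on the quadrant\<close>

text \<open>The derivative is one-sided at \<open>x = 0\<close>. By symmetry of rewards,
  \<open>partial_left f y x\<close> is the partial derivative in the second argument, so one
  definition serves both endpoints of an edge.\<close>

definition partial_left :: "(real \<Rightarrow> real \<Rightarrow> real) \<Rightarrow> real \<Rightarrow> real \<Rightarrow> real" where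
  "partial_left f x y = vector_derivative (\<lambda>x. f x y) (at x within {0..})"

lemma reward_function_has_derivative:
  assumes f: "reward_function f" and x: "0 \<le> x" and y: "0 \<le> y"
  shows "((\<lambda>(x, y). f x y) has_derivative
     (\<lambda>(h, k). partial_left f x y * h + partial_left f y x * k))
     (at (x, y) within {0..} \<times> {0..})"
proof -
  let ?Q = "{0..} \<times> {0..} :: (real \<times> real) set"
  obtain D where D: "((\<lambda>(x, y). f x y) has_derivative D) (at (x, y) within ?Q)"
    using f x y by (force simp: reward_function_def differentiable_on_def differentiable_def)
  interpret D: bounded_linear D using D by (rule has_derivative_bounded_linear)
  \<comment> \<open>Nontriviality of the filter, also at the boundary point 0, makes the derivative
    unique; this lets \<open>vector_derivative\<close> be identified with the coordinates of
    \<open>D\<close>.\<close>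
  have nt: "at z within {0::real..} \<noteq> bot" if "0 \<le> z" for z :: real
  proof -
    have "at z within {z..} \<noteq> bot"
      using trivial_limit_at_right_real[of z] by (simp add: at_within_Ici_at_right)
    moreover have "at z within {z..} \<le> at z within {0..}"
      using that by (intro at_le) auto
    ultimately show ?thesis by (metis bot.extremum_uniqueI)
  qed
  have "((\<lambda>z. (\<lambda>(x, y). f x y) (z, y)) has_derivative (\<lambda>h. D (h, 0))) (at x within {0..})"
    by (rule has_derivative_in_compose[where f = "\<lambda>z. (z, y)" and f' = "\<lambda>h. (h, 0)"])
      (use y in \<open>auto intro!: derivative_eq_intros has_derivative_subset[OF D]\<close>)
  moreover have "h *\<^sub>R D (1, 0) = D (h, 0)" for h
    using D.scaleR[of h "(1, 0)"] by simp
  ultimately have 1: "partial_left f x y = D (1, 0)"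
    unfolding partial_left_def
    by (intro vector_derivative_within nt x) (simp add: has_vector_derivative_def del: real_scaleR_def)
  have "((\<lambda>z. (\<lambda>(x, y). f x y) (x, z)) has_derivative (\<lambda>k. D (0, k))) (at y within {0..})"
    by (rule has_derivative_in_compose[where f = "\<lambda>z. (x, z)" and f' = "\<lambda>k. (0, k)"])
      (use x in \<open>auto intro!: derivative_eq_intros has_derivative_subset[OF D]\<close>)
  moreover have "k *\<^sub>R D (0, 1) = D (0, k)" for k
    using D.scaleR[of k "(0, 1)"] by simp
  ultimately have "((\<lambda>z. f x z) has_vector_derivative D (0, 1)) (at y within {0..})"
    by (simp add: has_vector_derivative_def del: real_scaleR_def)
  \<comment> \<open>Symmetry of \<open>f\<close> on the quadrant turns the derivative in the second
    argument into one in the first argument with \<open>x\<close> and \<open>y\<close>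
    exchanged.\<close>
  then have "((\<lambda>z. f z x) has_vector_derivative D (0, 1)) (at y within {0..})"
    by (rule has_vector_derivative_transform[rotated 2])
      (use f x y in \<open>auto simp: reward_function_def\<close>)
  then have 2: "partial_left f y x = D (0, 1)"
    unfolding partial_left_def by (intro vector_derivative_within nt y)
  have "D (h, k) = partial_left f x y * h + partial_left f y x * k" for h k
  proof -
    have "(h, k) = h *\<^sub>R (1, 0) + k *\<^sub>R (0, 1)" by simp
    then show ?thesis by (simp only: D.add D.scaleR 1 2) simp
  qed
  then have "D = (\<lambda>(h, k). partial_left f x y * h + partial_left f y x * k)" by auto
  with D show ?thesis by simp
qed

lemma reward_function_segment_derivative:
  assumes f: "reward_function f" and "0 \<le> x" "0 \<le> y" "0 \<le> x'" "0 \<le> y'"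
  shows "((\<lambda>r. f (x + r * (x' - x)) (y + r * (y' - y))) has_real_derivative
     partial_left f x y * (x' - x) + partial_left f y x * (y' - y)) (at 0 within {0..1})"
proof -
  have nonneg: "0 \<le> z + r * (z' - z)" if "0 \<le> z" "0 \<le> z'" "0 \<le> r" "r \<le> 1" for z z' r :: real
  proof -
    have "0 \<le> (1 - r) * z + r * z'" using that by simp
    then show ?thesis by (simp add: algebra_simps)
  qed
  let ?g = "\<lambda>r. (x + r * (x' - x), y + r * (y' - y))"
  have "((\<lambda>r. (\<lambda>(x, y). f x y) (?g r)) has_derivative
      (\<lambda>r. (\<lambda>(h, k). partial_left f x y * h + partial_left f y x * k)
         (r * (x' - x), r * (y' - y)))) (at 0 within {0..1})"
  proof (rule has_derivative_in_compose[where f = ?g])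
    show "(?g has_derivative (\<lambda>r. (r * (x' - x), r * (y' - y)))) (at 0 within {0..1})"
      by (auto intro!: derivative_eq_intros)
    have "?g ` {0..1} \<subseteq> {0..} \<times> {0..}"
      using assms nonneg by auto
    then show "((\<lambda>(x, y). f x y) has_derivative
        (\<lambda>(h, k). partial_left f x y * h + partial_left f y x * k))
        (at (?g 0) within ?g ` {0..1})"
      using has_derivative_subset[OF reward_function_has_derivative[OF f]] assms by simp
  qed
  then show ?thesis
    by (simp add: has_field_derivative_def)
      (rule has_derivative_eq_rhs, assumption, auto simp: algebra_simps)
qed

lemma concave_reward_below_tangent:
  assumes f: "reward_function f" and c: "concave_on ({0..} \<times> {0..}) (\<lambda>(x, y). f x y)"
    and nn: "0 \<le> x" "0 \<le> y" "0 \<le> x'" "0 \<le> y'"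
  shows "f x' y' - f x y \<le> partial_left f x y * (x' - x) + partial_left f y x * (y' - y)"
proof (rule ccontr)
  let ?D = "partial_left f x y * (x' - x) + partial_left f y x * (y' - y)"
  let ?\<Delta> = "f x' y' - f x y"
  \<comment> \<open>The reward along the segment minus the linear growth of the chord: concavity
    keeps it at or above its value at 0, while a failing tangent bound gives it a negative
    derivative there.\<close>
  let ?\<psi> = "\<lambda>r. f (x + r * (x' - x)) (y + r * (y' - y)) - r * ?\<Delta>"
  assume "\<not> ?thesis"
  then have "?D - ?\<Delta> < 0" by simp
  moreover have "(?\<psi> has_real_derivative ?D - ?\<Delta>) (at 0 within {0..1})"
    by (auto intro!: derivative_eq_intros reward_function_segment_derivative[OF f nn])
  ultimately obtain d where d: "0 < d" "\<And>h. 0 < h \<Longrightarrow> 0 + h \<in> {0..1} \<Longrightarrow> h < d \<Longrightarrow> ?\<psi> (0 + h) < ?\<psi> 0"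
    using has_real_derivative_neg_dec_right[of ?\<psi> "?D - ?\<Delta>" 0 "{0..1}"] by auto
  define h where "h = min 1 (d / 2)"
  have h: "0 < h" "h \<le> 1" "h < d" using d(1) by (auto simp: h_def)
  have "(1 - h) * f x y + h * f x' y' \<le> f (x + h * (x' - x)) (y + h * (y' - y))"
    using concave_onD[OF c, of h "(x, y)" "(x', y')"] h nn by (simp add: algebra_simps)
  then have "?\<psi> 0 \<le> ?\<psi> h" by (simp add: algebra_simps)
  moreover have "?\<psi> h < ?\<psi> 0" using d(2)[of h] h by simp
  ultimately show False by simp
qed

section \<open>First-order conditions at an equilibrium\<close>

definition neighbours :: "'v contribution_game \<Rightarrow> 'v \<Rightarrow> 'v set" where
  "neighbours G v = {u \<in> verts G. {v, u} \<in> edges G}"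

definition marginal :: "'v contribution_game \<Rightarrow> ('v \<Rightarrow> 'v set \<Rightarrow> real) \<Rightarrow> 'v \<Rightarrow> 'v \<Rightarrow> real" where
  "marginal G s v u = partial_left (reward G {v, u}) (s v {v, u}) (s u {v, u})"

lemma utility_neighbours:
  "utility G s v = (\<Sum>u\<in>neighbours G v. reward G {v, u} (s v {v, u}) (s u {v, u}))"
  by (simp add: utility_def neighbours_def)

lemma finite_neighbours: "network_contribution_game G \<Longrightarrow> finite (neighbours G v)"
  by (simp add: neighbours_def network_contribution_game_def)

lemma neighbours_sym:
  "v \<in> verts G \<Longrightarrow> u \<in> neighbours G v \<Longrightarrow> v \<in> neighbours G u"
  by (auto simp: neighbours_def insert_commute)

lemma neighbour_neq:
  assumes "network_contribution_game G" "u \<in> neighbours G v"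
  shows "u \<noteq> v"
  using assms by (auto simp: neighbours_def network_contribution_game_def)

lemma neighbours_reward_function:
  assumes "network_contribution_game G" "u \<in> neighbours G v"
  shows "reward_function (reward G {v, u})"
  using assms by (auto simp: neighbours_def network_contribution_game_def)

lemma neighbours_in_verts: "u \<in> neighbours G v \<Longrightarrow> u \<in> verts G"
  by (simp add: neighbours_def)

text \<open>Budgets are sums over incident edges, utilities are sums over neighbours. An edge with
  two elements that contains \<open>v\<close> determines its other endpoint, so the two index sets
  correspond.\<close>

lemma bij_betw_neighbours_incident:
  assumes G: "network_contribution_game G"
  shows "bij_betw (\<lambda>u. {v, u}) (neighbours G v) (incident G v)"
proof (rule bij_betw_imageI)
  show "inj_on (\<lambda>u. {v, u}) (neighbours G v)"
    by (auto simp: inj_on_def doubleton_eq_iff)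
  have "e \<in> (\<lambda>u. {v, u}) ` neighbours G v" if e: "e \<in> edges G" "v \<in> e" for e
  proof -
    have "card e = 2" "e \<subseteq> verts G"
      using G e by (auto simp: network_contribution_game_def)
    then obtain u where "e = {v, u}"
      using e(2) by (auto simp: card_2_iff)
    with e \<open>e \<subseteq> verts G\<close> show ?thesis by (auto simp: neighbours_def)
  qed
  then show "(\<lambda>u. {v, u}) ` neighbours G v = incident G v"
    by (auto simp: incident_def neighbours_def)
qed

lemma sum_incident:
  assumes "network_contribution_game G"
  shows "(\<Sum>e\<in>incident G v. h e) = (\<Sum>u\<in>neighbours G v. h {v, u})"
  using sum.reindex_bij_betw[OF bij_betw_neighbours_incident[OF assms], of h] by simp

lemma strategy_nonneg:
  assumes "x \<in> strategies G v" "u \<in> neighbours G v"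
  shows "0 \<le> x {v, u}"
  using assms by (fastforce simp: strategies_def incident_def neighbours_def PiE_iff)

lemma strategy_sum_le:
  assumes "network_contribution_game G" "x \<in> strategies G v"
  shows "(\<Sum>u\<in>neighbours G v. x {v, u}) \<le> budget G v"
  using assms by (simp add: strategies_def flip: sum_incident)

text \<open>Builds a strategy from contributions given per neighbour, by inverting the
  correspondence with incident edges.\<close>

lemma strategyI:
  assumes G: "network_contribution_game G"
    and "\<And>u. u \<in> neighbours G v \<Longrightarrow> 0 \<le> h u" "(\<Sum>u\<in>neighbours G v. h u) \<le> budget G v"
  obtains x where "x \<in> strategies G v" "\<And>u. u \<in> neighbours G v \<Longrightarrow> x {v, u} = h u"
proof -
  let ?b = "\<lambda>u. {v, u}"
  define x where "x = restrict (\<lambda>e. h (inv_into (neighbours G v) ?b e)) (incident G v)"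
  note bij = bij_betw_neighbours_incident[OF G, of v]
  have mem: "{v, u} \<in> incident G v" if "u \<in> neighbours G v" for u
    using bij that by (auto simp: bij_betw_def)
  have x: "x {v, u} = h u" if "u \<in> neighbours G v" for u
    using bij_betw_inv_into_left[OF bij that] mem[OF that] by (simp add: x_def)
  have "x e \<ge> 0" if "e \<in> incident G v" for e
  proof -
    obtain u where "u \<in> neighbours G v" "e = {v, u}"
      using bij_betw_imp_surj_on[OF bij] \<open>e \<in> incident G v\<close> by blast
    then show ?thesis using assms(2) x by simp
  qed
  moreover have "(\<Sum>e\<in>incident G v. x e) \<le> budget G v"
    using assms(3) x by (simp add: sum_incident[OF G])
  moreover have "x \<in> extensional (incident G v)" by (simp add: x_def)
  ultimately have "x \<in> strategies G v" by (auto simp: strategies_def PiE_iff)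
  with x show ?thesis by (rule that[rotated])
qed

lemma strategies_convex_combination:
  assumes G: "network_contribution_game G"
    and x: "x \<in> strategies G v" and y: "y \<in> strategies G v" and r: "0 \<le> r" "r \<le> 1"
  shows "(\<lambda>e. x e + r * (y e - x e)) \<in> strategies G v"
proof -
  have eq: "x e + r * (y e - x e) = (1 - r) * x e + r * y e" for e
    by (simp add: algebra_simps)
  have "(\<Sum>e\<in>incident G v. x e + r * (y e - x e)) =
      (1 - r) * (\<Sum>e\<in>incident G v. x e) + r * (\<Sum>e\<in>incident G v. y e)"
    by (simp add: eq sum.distrib sum_distrib_left)
  also have "\<dots> \<le> (1 - r) * budget G v + r * budget G v"
    using x y r by (intro add_mono mult_left_mono) (auto simp: strategies_def)
  finally have "(\<Sum>e\<in>incident G v. x e + r * (y e - x e)) \<le> budget G v"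
    by (simp add: algebra_simps)
  moreover have "0 \<le> x e + r * (y e - x e)" if "e \<in> incident G v" for e
    unfolding eq using x y r that by (auto simp: strategies_def PiE_iff)
  \<comment> \<open>Off the incident edges \<open>x\<close> and \<open>y\<close> both equal
    \<open>undefined\<close>, so the difference vanishes and the combination is
    \<open>undefined\<close> as well.\<close>
  moreover have "(\<lambda>e. x e + r * (y e - x e)) \<in> extensional (incident G v)"
    using x y by (auto simp: strategies_def PiE_iff extensional_def)
  ultimately show ?thesis by (auto simp: strategies_def PiE_iff)
qed

section \<open>First-order change of utilities along segments of states\<close>

lemma states_strategies: "s \<in> states G \<Longrightarrow> v \<in> verts G \<Longrightarrow> s v \<in> strategies G v"
  by (auto simp: states_def)

lemma state_nonneg:
  assumes s: "s \<in> states G" and v: "v \<in> verts G" and u: "u \<in> neighbours G v"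
  shows "0 \<le> s v {v, u}" "0 \<le> s u {v, u}"
proof -
  show "0 \<le> s v {v, u}" using strategy_nonneg[OF states_strategies[OF s v] u] .
  have "u \<in> verts G" using u by (simp add: neighbours_def)
  then show "0 \<le> s u {v, u}"
    using strategy_nonneg[OF states_strategies[OF s] neighbours_sym[OF v u]]
    by (simp add: insert_commute)
qed

text \<open>The derivative at \<open>s\<close>, in the direction of \<open>t\<close>, of the reward
  of the edge \<open>{v, u}\<close>. Both endpoints receive this same gain.\<close>

definition linear_gain ::
  "'v contribution_game \<Rightarrow> ('v \<Rightarrow> 'v set \<Rightarrow> real) \<Rightarrow> ('v \<Rightarrow> 'v set \<Rightarrow> real) \<Rightarrow> 'v \<Rightarrow> 'v \<Rightarrow> real" where
  "linear_gain G s t v u =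
     marginal G s v u * (t v {v, u} - s v {v, u}) + marginal G s u v * (t u {v, u} - s u {v, u})"

lemma linear_gain_commute: "linear_gain G s t v u = linear_gain G s t u v"
  by (simp add: linear_gain_def insert_commute)

lemma utility_segment_derivative:
  assumes G: "network_contribution_game G" and s: "s \<in> states G" and t: "t \<in> states G"
    and v: "v \<in> verts G"
  shows "((\<lambda>r. utility G (\<lambda>w e. s w e + r * (t w e - s w e)) v) has_real_derivative
     (\<Sum>u\<in>neighbours G v. linear_gain G s t v u)) (at 0 within {0..1})"
  unfolding utility_neighbours linear_gain_def
proof (rule DERIV_sum)
  fix u assume u: "u \<in> neighbours G v"
  show "((\<lambda>r. reward G {v, u} (s v {v, u} + r * (t v {v, u} - s v {v, u}))
         (s u {v, u} + r * (t u {v, u} - s u {v, u}))) has_real_derivative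
        marginal G s v u * (t v {v, u} - s v {v, u}) +
        marginal G s u v * (t u {v, u} - s u {v, u})) (at 0 within {0..1})"
    unfolding marginal_def insert_commute[of u v]
    by (rule reward_function_segment_derivative[OF neighbours_reward_function[OF G u]
          state_nonneg[OF s v u] state_nonneg[OF t v u]])
qed

text \<open>The threshold \<open>d\<close> is explicit so that one step size can be chosen below the
  thresholds of two players.\<close>

lemma utility_increases:
  assumes G: "network_contribution_game G" and s: "s \<in> states G" and t: "t \<in> states G"
    and v: "v \<in> verts G" and pos: "0 < (\<Sum>u\<in>neighbours G v. linear_gain G s t v u)"
  obtains d where "0 < d"
    "\<And>r. 0 < r \<Longrightarrow> r \<le> 1 \<Longrightarrow> r < d \<Longrightarrow>
       utility G s v < utility G (\<lambda>w e. s w e + r * (t w e - s w e)) v"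
  using has_real_derivative_pos_inc_right[OF utility_segment_derivative[OF G s t v] pos] that
  by auto

lemma states_update:
  "s \<in> states G \<Longrightarrow> v \<in> verts G \<Longrightarrow> x \<in> strategies G v \<Longrightarrow> s(v := x) \<in> states G"
  by (auto simp: states_def PiE_iff extensional_def)

text \<open>If the inequality failed, the utility of \<open>v\<close> would have a positive
  derivative towards \<open>x\<close>, and a short step in that direction, feasible by convexity,
  would be an improving unilateral deviation.\<close>

lemma nash_first_order:
  assumes G: "network_contribution_game G" and N: "nash_equilibrium G s"
    and v: "v \<in> verts G" and x: "x \<in> strategies G v"
  shows "(\<Sum>u\<in>neighbours G v. marginal G s v u * x {v, u}) \<le>
     (\<Sum>u\<in>neighbours G v. marginal G s v u * s v {v, u})"
proof (rule ccontr)
  assume less: "\<not> ?thesis"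
  have s: "s \<in> states G" using N by (simp add: nash_equilibrium_def)
  have "linear_gain G s (s(v := x)) v u = marginal G s v u * x {v, u} - marginal G s v u * s v {v, u}"
    if "u \<in> neighbours G v" for u
    using neighbour_neq[OF G that] by (simp add: linear_gain_def algebra_simps)
  then have "0 < (\<Sum>u\<in>neighbours G v. linear_gain G s (s(v := x)) v u)"
    using less by (simp add: sum_subtractf)
  then obtain d where d: "0 < d" "\<And>r. 0 < r \<Longrightarrow> r \<le> 1 \<Longrightarrow> r < d \<Longrightarrow>
      utility G s v < utility G (\<lambda>w e. s w e + r * ((s(v := x)) w e - s w e)) v"
    using utility_increases[OF G s states_update[OF s v x] v] by blast
  define r where "r = min 1 (d / 2)"
  have r: "0 < r" "r \<le> 1" "r < d" using d(1) by (auto simp: r_def)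
  have "(\<lambda>w e. s w e + r * ((s(v := x)) w e - s w e)) = s(v := \<lambda>e. s v e + r * (x e - s v e))"
    by auto
  with d(2)[OF r] have "utility G s v < utility G (s(v := \<lambda>e. s v e + r * (x e - s v e))) v"
    by simp
  moreover have "(\<lambda>e. s v e + r * (x e - s v e)) \<in> strategies G v"
    using strategies_convex_combination[OF G states_strategies[OF s v] x] r by simp
  ultimately show False using N v by (force simp: nash_equilibrium_def)
qed

text \<open>The two left-hand sides are the derivatives of the utilities of \<open>v\<close> and
  \<open>u\<close> when both move towards \<open>x\<close> and \<open>y\<close>; the partner's move
  matters only on the shared edge. Were both positive, a short common step would improve both
  players.\<close>

lemma pairwise_first_order:
  assumes G: "network_contribution_game G" and P: "pairwise_equilibrium G s"
    and v: "v \<in> verts G" and u: "u \<in> neighbours G v"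
    and x: "x \<in> strategies G v" and y: "y \<in> strategies G u"
  shows "(\<Sum>w\<in>neighbours G v. marginal G s v w * (x {v, w} - s v {v, w}))
           + marginal G s u v * (y {u, v} - s u {u, v}) \<le> 0 \<or>
         (\<Sum>w\<in>neighbours G u. marginal G s u w * (y {u, w} - s u {u, w}))
           + marginal G s v u * (x {v, u} - s v {v, u}) \<le> 0"
proof (rule ccontr)
  assume neg: "\<not> ?thesis"
  have s: "s \<in> states G" using P by (simp add: pairwise_equilibrium_def nash_equilibrium_def)
  have uV: "u \<in> verts G" using u by (rule neighbours_in_verts)
  have ne: "u \<noteq> v" using neighbour_neq[OF G u] .
  define t where "t = s(v := x, u := y)"
  have t: "t \<in> states G" unfolding t_def by (intro states_update s v uV x y)
  \<comment> \<open>Only \<open>v\<close> and \<open>u\<close> move, and no player is its own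
    neighbour, so among the neighbours of \<open>p\<close> only \<open>q\<close> changes its
    contribution.\<close>
  have split: "(\<Sum>w\<in>neighbours G p. linear_gain G s t p w) =
      (\<Sum>w\<in>neighbours G p. marginal G s p w * (t p {p, w} - s p {p, w}))
        + marginal G s q p * (t q {q, p} - s q {q, p})"
    if pq: "{p, q} = {v, u}" and q: "q \<in> neighbours G p" for p q
  proof -
    have "(\<Sum>w\<in>neighbours G p. marginal G s w p * (t w {p, w} - s w {p, w})) =
        (\<Sum>w\<in>neighbours G p. if w = q then marginal G s q p * (t q {p, q} - s q {p, q}) else 0)"
      using pq neighbour_neq[OF G]
      by (intro sum.cong) (auto simp: t_def doubleton_eq_iff)
    then show ?thesis
      using q finite_neighbours[OF G]
      by (simp add: linear_gain_def sum.distrib insert_commute)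
  qed
  have "0 < (\<Sum>w\<in>neighbours G v. linear_gain G s t v w)"
    using split[of v u] u neg ne by (simp add: t_def)
  then obtain d where d: "0 < d" "\<And>r. 0 < r \<Longrightarrow> r \<le> 1 \<Longrightarrow> r < d \<Longrightarrow>
      utility G s v < utility G (\<lambda>w e. s w e + r * (t w e - s w e)) v"
    using utility_increases[OF G s t v] by blast
  have "0 < (\<Sum>w\<in>neighbours G u. linear_gain G s t u w)"
    using split[of u v] neighbours_sym[OF v u] neg ne by (simp add: t_def insert_commute)
  then obtain d' where d': "0 < d'" "\<And>r. 0 < r \<Longrightarrow> r \<le> 1 \<Longrightarrow> r < d' \<Longrightarrow>
      utility G s u < utility G (\<lambda>w e. s w e + r * (t w e - s w e)) u"
    using utility_increases[OF G s t uV] by blast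
  define r where "r = min 1 (min d d' / 2)"
  have r: "0 < r" "r \<le> 1" "r < d" "r < d'" using d(1) d'(1) by (auto simp: r_def)
  let ?x = "\<lambda>e. s v e + r * (x e - s v e)" and ?y = "\<lambda>e. s u e + r * (y e - s u e)"
  have "(\<lambda>w e. s w e + r * (t w e - s w e)) = s(v := ?x, u := ?y)"
    using ne by (auto simp: t_def)
  with d(2)[of r] d'(2)[of r] r
  have "utility G s v < utility G (s(v := ?x, u := ?y)) v"
    "utility G s u < utility G (s(v := ?x, u := ?y)) u"
    by simp_all
  moreover have "?x \<in> strategies G v" "?y \<in> strategies G u"
    using strategies_convex_combination[OF G] states_strategies[OF s] v uV x y r by auto
  ultimately have "improving_bilateral_deviation G s v u ?x ?y"
    using v uV ne by (simp add: improving_bilateral_deviation_def)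
  with P show False by (auto simp: pairwise_equilibrium_def)
qed

text \<open>The Lagrange multiplier of the budget constraint of \<open>v\<close>. Inserting 0 makes
  it nonnegative and covers players without neighbours.\<close>

definition multiplier :: "'v contribution_game \<Rightarrow> ('v \<Rightarrow> 'v set \<Rightarrow> real) \<Rightarrow> 'v \<Rightarrow> real" where
  "multiplier G s v = Max (insert 0 (marginal G s v ` neighbours G v))"

lemma marginal_le_multiplier:
  "network_contribution_game G \<Longrightarrow> u \<in> neighbours G v \<Longrightarrow> marginal G s v u \<le> multiplier G s v"
  by (simp add: multiplier_def finite_neighbours)

lemma multiplier_nonneg: "network_contribution_game G \<Longrightarrow> 0 \<le> multiplier G s v"
  by (simp add: multiplier_def finite_neighbours)

text \<open>Complementary slackness. The chain from \<open>?l * budget G v\<close> over the sums of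
  \<open>?m u * s v {v, u}\<close> and \<open>?l * s v {v, u}\<close> back to
  \<open>?l * budget G v\<close> collapses to equalities, first in total and then termwise.\<close>

lemma nash_multiplier:
  assumes G: "network_contribution_game G" and N: "nash_equilibrium G s" and v: "v \<in> verts G"
  shows "multiplier G s v * (\<Sum>u\<in>neighbours G v. s v {v, u}) = multiplier G s v * budget G v"
    and "\<And>u. u \<in> neighbours G v \<Longrightarrow>
           marginal G s v u * s v {v, u} = multiplier G s v * s v {v, u}"
proof -
  let ?l = "multiplier G s v" and ?N = "neighbours G v" and ?m = "marginal G s v"
  have s: "s \<in> states G" using N by (simp add: nash_equilibrium_def)
  have B: "0 \<le> budget G v" using G v by (simp add: network_contribution_game_def)
  have fin: "finite ?N" by (rule finite_neighbours[OF G])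
  have s_nonneg: "0 \<le> s v {v, u}" if "u \<in> ?N" for u
    using state_nonneg(1)[OF s v that] .
  have le: "?m u * s v {v, u} \<le> ?l * s v {v, u}" if "u \<in> ?N" for u
    using marginal_le_multiplier[OF G that] s_nonneg[OF that] by (rule mult_right_mono)
  have "?l * budget G v \<le> (\<Sum>u\<in>?N. ?m u * s v {v, u})"
  proof -
    have "?l \<in> insert 0 (?m ` ?N)"
      unfolding multiplier_def using fin by (intro Max_in) auto
    \<comment> \<open>The comparison strategy for \<open>nash_first_order\<close> is the zero
      strategy if the multiplier is 0, and otherwise the whole budget on an edge
      \<open>{v, w}\<close> of maximal marginal.\<close>
    then consider "?l = 0" | w where "w \<in> ?N" "?l = ?m w" by blast
    then show ?thesis
    proof cases
      case 1
      obtain x where "x \<in> strategies G v" "\<And>u. u \<in> ?N \<Longrightarrow> x {v, u} = 0"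
        using strategyI[OF G, where v = v and h = "\<lambda>_. 0"] B by auto
      with nash_first_order[OF G N v] 1 show ?thesis by fastforce
    next
      case 2
      let ?h = "\<lambda>u. if u = w then budget G v else 0"
      have "(\<Sum>u\<in>?N. ?h u) \<le> budget G v" using B fin by simp
      then obtain x where x: "x \<in> strategies G v" "\<And>u. u \<in> ?N \<Longrightarrow> x {v, u} = ?h u"
        by (rule strategyI[OF G, where v = v and h = ?h, rotated]) (use B in auto)
      have "(\<Sum>u\<in>?N. ?m u * x {v, u}) = (\<Sum>u\<in>?N. if u = w then ?m w * budget G v else 0)"
        using x(2) by (intro sum.cong) auto
      then have "(\<Sum>u\<in>?N. ?m u * x {v, u}) = ?l * budget G v"
        using 2 fin by simp
      with nash_first_order[OF G N v x(1)] show ?thesis by simp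
    qed
  qed
  also have upper: "\<dots> \<le> (\<Sum>u\<in>?N. ?l * s v {v, u})" by (intro sum_mono le)
  finally have lower: "?l * budget G v \<le> ?l * (\<Sum>u\<in>?N. s v {v, u})"
    by (simp add: sum_distrib_left)
  have "?l * (\<Sum>u\<in>?N. s v {v, u}) \<le> ?l * budget G v"
    using strategy_sum_le[OF G states_strategies[OF s v]] multiplier_nonneg[OF G]
    by (intro mult_left_mono)
  then show eq: "?l * (\<Sum>u\<in>?N. s v {v, u}) = ?l * budget G v"
    using lower by (rule order_antisym)
  have "(\<Sum>u\<in>?N. ?l * s v {v, u} - ?m u * s v {v, u}) = 0"
    using \<open>?l * budget G v \<le> (\<Sum>u\<in>?N. ?m u * s v {v, u})\<close> upper eq
    by (simp add: sum_subtractf sum_distrib_left)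
  then have "\<forall>u\<in>?N. ?l * s v {v, u} - ?m u * s v {v, u} = 0"
    using le fin by (subst (asm) sum_nonneg_eq_0_iff) auto
  then have "?l * s v {v, u} - ?m u * s v {v, u} = 0" if "u \<in> ?N" for u
    using that by (rule bspec)
  then show "?m u * s v {v, u} = ?l * s v {v, u}" if "u \<in> ?N" for u
    using that by (metis eq_iff_diff_eq_0)
qed

section \<open>Charging edges to players\<close>

text \<open>The strategy moves the contribution to \<open>{v, u}\<close> to \<open>z\<close> and scales down all others.\<close>

lemma nash_shift:
  assumes G: "network_contribution_game G" and N: "nash_equilibrium G s" and v: "v \<in> verts G"
    and u: "u \<in> neighbours G v" and z: "s v {v, u} < z" "z \<le> budget G v"
  obtains x where "x \<in> strategies G v" "x {v, u} = z"
    "(\<Sum>w\<in>neighbours G v. marginal G s v w * (x {v, w} - s v {v, w})) =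
       (marginal G s v u - multiplier G s v) * (z - s v {v, u})"
proof -
  let ?l = "multiplier G s v" and ?N = "neighbours G v" and ?m = "marginal G s v"
  let ?B = "budget G v" and ?a = "s v {v, u}"
  have s: "s \<in> states G" using N by (simp add: nash_equilibrium_def)
  have fin: "finite ?N" by (rule finite_neighbours[OF G])
  have s_nonneg: "0 \<le> s v {v, w}" if "w \<in> ?N" for w
    using state_nonneg(1)[OF s v that] .
  \<comment> \<open>In \<open>s\<close> the other contributions total at most
    \<open>?B - ?a\<close>; scaled by \<open>c\<close> they total at most \<open>?B - z\<close>,
    which is what remains after contributing \<open>z\<close>.\<close>
  define c where "c = (?B - z) / (?B - ?a)"
  have c: "0 \<le> c" "c * (?B - ?a) = ?B - z" using z by (auto simp: c_def)
  define h where "h w = (if w = u then z else c * s v {v, w})" for w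
  have rest: "(\<Sum>w\<in>?N - {u}. s v {v, w}) = (\<Sum>w\<in>?N. s v {v, w}) - ?a"
    using fin u by (simp add: sum_diff1)
  have "(\<Sum>w\<in>?N. h w) = z + (\<Sum>w\<in>?N - {u}. h w)"
    using fin u by (subst sum.remove[of _ u]) (auto simp: h_def)
  also have "(\<Sum>w\<in>?N - {u}. h w) = c * (\<Sum>w\<in>?N - {u}. s v {v, w})"
    unfolding sum_distrib_left by (intro sum.cong) (auto simp: h_def)
  also have "\<dots> \<le> c * (?B - ?a)"
    using rest strategy_sum_le[OF G states_strategies[OF s v]] c(1)
    by (intro mult_left_mono) auto
  finally have "(\<Sum>w\<in>?N. h w) \<le> ?B" using c(2) by simp
  moreover have "0 \<le> h w" if "w \<in> ?N" for w
    using that s_nonneg[OF that] s_nonneg[OF u] c(1) z by (auto simp: h_def)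
  ultimately obtain x where x: "x \<in> strategies G v" "\<And>w. w \<in> ?N \<Longrightarrow> x {v, w} = h w"
    using strategyI[OF G] by metis
  have "(\<Sum>w\<in>?N. ?m w * (x {v, w} - s v {v, w})) =
      ?m u * (z - ?a) + (\<Sum>w\<in>?N - {u}. ?m w * (x {v, w} - s v {v, w}))"
    using fin u x(2)[OF u] by (subst sum.remove[of _ u]) (auto simp: h_def)
  \<comment> \<open>Scaling changes each other contribution in proportion to itself, so
    complementary slackness lets the multiplier replace every marginal.\<close>
  also have "(\<Sum>w\<in>?N - {u}. ?m w * (x {v, w} - s v {v, w})) =
      (\<Sum>w\<in>?N - {u}. (c - 1) * (?l * s v {v, w}))"
  proof (intro sum.cong refl)
    fix w assume w: "w \<in> ?N - {u}"
    then have "?m w * (x {v, w} - s v {v, w}) = (c - 1) * (?m w * s v {v, w})"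
      using x(2) by (simp add: h_def algebra_simps)
    with w show "?m w * (x {v, w} - s v {v, w}) = (c - 1) * (?l * s v {v, w})"
      using nash_multiplier(2)[OF G N v] by simp
  qed
  also have "\<dots> = (c - 1) * (?l * (\<Sum>w\<in>?N - {u}. s v {v, w}))"
    by (simp add: sum_distrib_left)
  \<comment> \<open>If the budget is not exhausted then \<open>?l = 0\<close>, so in either case the
    spent amount may be replaced by the budget.\<close>
  also have "?l * (\<Sum>w\<in>?N - {u}. s v {v, w}) = ?l * (?B - ?a)"
    using nash_multiplier(1)[OF G N v] by (simp add: rest algebra_simps)
  also have "(c - 1) * (?l * (?B - ?a)) = ?l * (c * (?B - ?a)) - ?l * (?B - ?a)"
    by (simp add: algebra_simps)
  also have "\<dots> = - ?l * (z - ?a)"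
    unfolding c(2) by (simp add: algebra_simps)
  finally have "(\<Sum>w\<in>?N. ?m w * (x {v, w} - s v {v, w})) = (?m u - ?l) * (z - ?a)"
    by (simp add: algebra_simps)
  with x u show ?thesis by (intro that[of x]) (auto simp: h_def)
qed

lemma state_le_budget:
  assumes G: "network_contribution_game G" and t: "t \<in> states G" and v: "v \<in> verts G"
    and u: "u \<in> neighbours G v"
  shows "t v {v, u} \<le> budget G v"
proof -
  have "t v {v, u} \<le> (\<Sum>w\<in>neighbours G v. t v {v, w})"
    using finite_neighbours[OF G] state_nonneg(1)[OF t v] u
    by (intro member_le_sum[where f = "\<lambda>w. t v {v, w}"]) auto
  also have "\<dots> \<le> budget G v"
    using strategy_sum_le[OF G states_strategies[OF t v]] .
  finally show ?thesis .
qed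

text \<open>A decrease towards \<open>t\<close> is possible only where \<open>s\<close> contributes
  a positive amount, and there the marginal equals the multiplier. For an increase it is enough that
  the multiplier bounds the marginal.\<close>

lemma nash_marginal_direction:
  assumes G: "network_contribution_game G" and N: "nash_equilibrium G s"
    and t: "t \<in> states G" and v: "v \<in> verts G" and u: "u \<in> neighbours G v"
  defines "d \<equiv> t v {v, u} - s v {v, u}"
  shows "marginal G s v u * d \<le> multiplier G s v * d"
    and "d \<le> 0 \<Longrightarrow> marginal G s v u * d \<le> 0"
proof -
  have s: "s \<in> states G" using N by (simp add: nash_equilibrium_def)
  have neg: "marginal G s v u = multiplier G s v" if "d < 0"
    using nash_multiplier(2)[OF G N v u] state_nonneg(1)[OF t v u] that by (auto simp: d_def)
  show "marginal G s v u * d \<le> multiplier G s v * d"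
    using neg marginal_le_multiplier[OF G u, of s]
    by (cases "d < 0") (auto intro: mult_right_mono)
  show "marginal G s v u * d \<le> 0" if "d \<le> 0"
    using neg multiplier_nonneg[OF G, of s v] that
    by (cases "d = 0") (auto simp: mult_nonneg_nonpos)
qed

text \<open>If one endpoint does not increase its contribution, its term is at most 0 and the Nash
  conditions charge the other endpoint. If both increase, both shift budget to the edge: the
  derivative for \<open>v\<close> is the linear gain minus \<open>multiplier G s v\<close> times its
  increase, likewise for \<open>u\<close>, and bilateral stability makes one of the two
  nonpositive.\<close>

lemma linear_gain_charge:
  assumes G: "network_contribution_game G" and P: "pairwise_equilibrium G s"
    and t: "t \<in> states G" and v: "v \<in> verts G" and u: "u \<in> neighbours G v"
  shows "linear_gain G s t v u \<le> multiplier G s v * (t v {v, u} - s v {v, u}) \<or>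
         linear_gain G s t v u \<le> multiplier G s u * (t u {u, v} - s u {u, v})"
proof -
  have N: "nash_equilibrium G s" using P by (simp add: pairwise_equilibrium_def)
  have uV: "u \<in> verts G" and vu: "v \<in> neighbours G u"
    using neighbours_in_verts[OF u] neighbours_sym[OF v u] by auto
  let ?dv = "t v {v, u} - s v {v, u}" and ?du = "t u {u, v} - s u {u, v}"
  have gain: "linear_gain G s t v u = marginal G s v u * ?dv + marginal G s u v * ?du"
    by (simp add: linear_gain_def insert_commute)
  consider "?dv \<le> 0" | "?du \<le> 0" | "0 < ?dv" "0 < ?du" by linarith
  then show ?thesis
  proof cases
    case 1
    then show ?thesis
      using gain nash_marginal_direction(2)[OF G N t v u]
        nash_marginal_direction(1)[OF G N t uV vu] by linarith
  next
    case 2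
    then show ?thesis
      using gain nash_marginal_direction(1)[OF G N t v u]
        nash_marginal_direction(2)[OF G N t uV vu] by linarith
  next
    case 3
    obtain x where x: "x \<in> strategies G v" "x {v, u} = t v {v, u}"
      "(\<Sum>w\<in>neighbours G v. marginal G s v w * (x {v, w} - s v {v, w})) =
         (marginal G s v u - multiplier G s v) * ?dv"
      using nash_shift[OF G N v u, of "t v {v, u}"] 3 state_le_budget[OF G t v u] by auto
    obtain y where y: "y \<in> strategies G u" "y {u, v} = t u {u, v}"
      "(\<Sum>w\<in>neighbours G u. marginal G s u w * (y {u, w} - s u {u, w})) =
         (marginal G s u v - multiplier G s u) * ?du"
      using nash_shift[OF G N uV vu, of "t u {u, v}"] 3 state_le_budget[OF G t uV vu] by auto
    show ?thesis
      using pairwise_first_order[OF G P v u x(1) y(1)]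
      unfolding x(2,3) y(2,3) gain by (simp add: algebra_simps)
  qed
qed

section \<open>Paying for optimal rewards with equilibrium utilities\<close>

lemma reward_gain_le_linear_gain:
  assumes G: "network_contribution_game G" and C: "concave_rewards G"
    and s: "s \<in> states G" and t: "t \<in> states G" and v: "v \<in> verts G" and u: "u \<in> neighbours G v"
  shows "reward G {v, u} (t v {v, u}) (t u {v, u}) - reward G {v, u} (s v {v, u}) (s u {v, u})
     \<le> linear_gain G s t v u"
proof -
  have "concave_on ({0..} \<times> {0..}) (\<lambda>(x, y). reward G {v, u} x y)"
    using C u by (simp add: concave_rewards_def neighbours_def)
  from concave_reward_below_tangent[OF neighbours_reward_function[OF G u] this
      state_nonneg[OF s v u] state_nonneg[OF t v u]]
  show ?thesis by (simp add: linear_gain_def marginal_def insert_commute)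
qed

text \<open>The tangent at \<open>s\<close> lies above the reward that remains when \<open>v\<close>
  withdraws its contribution, and that reward is nonnegative.\<close>

lemma marginal_times_contribution_le_reward:
  assumes G: "network_contribution_game G" and C: "concave_rewards G"
    and s: "s \<in> states G" and v: "v \<in> verts G" and u: "u \<in> neighbours G v"
  shows "marginal G s v u * s v {v, u} \<le> reward G {v, u} (s v {v, u}) (s u {v, u})"
proof -
  have c: "concave_on ({0..} \<times> {0..}) (\<lambda>(x, y). reward G {v, u} x y)"
    using C u by (simp add: concave_rewards_def neighbours_def)
  note f = neighbours_reward_function[OF G u]
  have "0 \<le> reward G {v, u} 0 (s u {v, u})"
    using f state_nonneg(2)[OF s v u] by (simp add: reward_function_def)
  with concave_reward_below_tangent[OF f c state_nonneg[OF s v u] order_refl state_nonneg(2)[OF s v u]]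
  show ?thesis by (simp add: marginal_def)
qed

lemma charged_reward_le_utility:
  assumes G: "network_contribution_game G" and C: "concave_rewards G"
    and N: "nash_equilibrium G s" and t: "t \<in> states G" and v: "v \<in> verts G"
    and A: "A \<subseteq> neighbours G v"
    and charge: "\<And>u. u \<in> A \<Longrightarrow>
      linear_gain G s t v u \<le> multiplier G s v * (t v {v, u} - s v {v, u})"
  shows "(\<Sum>u\<in>A. reward G {v, u} (t v {v, u}) (t u {v, u})) \<le> utility G s v"
proof -
  let ?l = "multiplier G s v" and ?N = "neighbours G v"
  let ?F = "\<lambda>s u. reward G {v, u} (s v {v, u}) (s u {v, u})"
  have s: "s \<in> states G" using N by (simp add: nash_equilibrium_def)
  have fin: "finite ?N" by (rule finite_neighbours[OF G])
  have split: "(\<Sum>u\<in>?N. h u) = (\<Sum>u\<in>A. h u) + (\<Sum>u\<in>?N - A. h u)" for h :: "'a \<Rightarrow> real"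
    using sum.subset_diff[OF A fin, of h] by simp
  have "(\<Sum>u\<in>A. ?F t u) \<le> (\<Sum>u\<in>A. ?F s u + ?l * (t v {v, u} - s v {v, u}))"
    using charge reward_gain_le_linear_gain[OF G C s t v] A by (intro sum_mono) fastforce
  also have "\<dots> = (\<Sum>u\<in>A. ?F s u) + ?l * (\<Sum>u\<in>A. t v {v, u}) - ?l * (\<Sum>u\<in>A. s v {v, u})"
    by (simp add: sum.distrib sum_subtractf sum_distrib_left algebra_simps)
  also have "\<dots> \<le> (\<Sum>u\<in>A. ?F s u) + ?l * budget G v - ?l * (\<Sum>u\<in>A. s v {v, u})"
  proof -
    have "(\<Sum>u\<in>A. t v {v, u}) \<le> (\<Sum>u\<in>?N. t v {v, u})"
      using fin A state_nonneg(1)[OF t v] by (intro sum_mono2) auto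
    also have "\<dots> \<le> budget G v" using strategy_sum_le[OF G states_strategies[OF t v]] .
    finally show ?thesis using multiplier_nonneg[OF G, of s v] by (simp add: mult_left_mono)
  qed
  \<comment> \<open>Complementary slackness turns the priced budget back into the priced spending in
    \<open>s\<close>; the part on \<open>A\<close> cancels and the part on uncharged edges
    remains.\<close>
  also have "\<dots> = (\<Sum>u\<in>A. ?F s u) + (\<Sum>u\<in>?N - A. ?l * s v {v, u})"
    unfolding nash_multiplier(1)[OF G N v, symmetric] split[of "\<lambda>u. s v {v, u}"]
    by (simp add: sum_distrib_left algebra_simps)
  \<comment> \<open>On each uncharged edge the priced contribution equals marginal times
    contribution, which the reward in \<open>s\<close> covers.\<close>
  also have "(\<Sum>u\<in>?N - A. ?l * s v {v, u}) \<le> (\<Sum>u\<in>?N - A. ?F s u)"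
    using nash_multiplier(2)[OF G N v] marginal_times_contribution_le_reward[OF G C s v]
    by (intro sum_mono) fastforce
  finally show ?thesis by (simp add: utility_neighbours split)
qed

section \<open>The welfare bound and the price of anarchy\<close>

lemma utility_nonneg:
  assumes G: "network_contribution_game G" and s: "s \<in> states G" and v: "v \<in> verts G"
  shows "0 \<le> utility G s v"
  unfolding utility_neighbours
  using neighbours_reward_function[OF G] state_nonneg[OF s v]
  by (intro sum_nonneg) (simp add: reward_function_def)

lemma social_welfare_le_twice_equilibrium:
  assumes G: "network_contribution_game G" and C: "concave_rewards G"
    and P: "pairwise_equilibrium G s" and t: "t \<in> states G"
  shows "social_welfare G t \<le> 2 * social_welfare G s"
proof -
  have N: "nash_equilibrium G s" using P by (simp add: pairwise_equilibrium_def)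
  have finV: "finite (verts G)" using G by (simp add: network_contribution_game_def)
  define R where "R v u \<longleftrightarrow>
    linear_gain G s t v u \<le> multiplier G s v * (t v {v, u} - s v {v, u})" for v u
  define F where "F v u = reward G {v, u} (t v {v, u}) (t u {v, u})" for v u
  let ?N = "neighbours G"
  have F: "0 \<le> F v u" "F u v = F v u" if "v \<in> verts G" "u \<in> ?N v" for v u
    using neighbours_reward_function[OF G that(2)] state_nonneg[OF t that]
    by (auto simp: F_def reward_function_def insert_commute)
  have RR: "R v u \<or> R u v" if "v \<in> verts G" "u \<in> ?N v" for v u
    using linear_gain_charge[OF G P t that] linear_gain_commute[of G s t u v] by (simp add: R_def)
  have "social_welfare G t = (\<Sum>v\<in>verts G. \<Sum>u\<in>?N v. F v u)"
    by (simp add: social_welfare_def utility_neighbours F_def)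
  \<comment> \<open>Each edge is charged to at least one endpoint, so its reward is covered by the
    charges in its two orientations.\<close>
  also have "\<dots> \<le> (\<Sum>v\<in>verts G. \<Sum>u\<in>?N v. (if R v u then F v u else 0) + (if R u v then F u v else 0))"
  proof (intro sum_mono)
    fix v u assume vu: "v \<in> verts G" "u \<in> ?N v"
    show "F v u \<le> (if R v u then F v u else 0) + (if R u v then F u v else 0)"
      using F[OF vu] RR[OF vu] by auto
  qed
  also have "\<dots> = (\<Sum>v\<in>verts G. \<Sum>u\<in>?N v. if R v u then F v u else 0) +
      (\<Sum>v\<in>verts G. \<Sum>u\<in>?N v. if R u v then F u v else 0)"
    by (simp add: sum.distrib)
  also have "(\<Sum>v\<in>verts G. \<Sum>u\<in>?N v. if R u v then F u v else 0) =
      (\<Sum>u\<in>verts G. \<Sum>v\<in>?N u. if R u v then F u v else 0)"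
    unfolding neighbours_def
    using sum.swap_restrict[OF finV finV, of "\<lambda>v u. if R u v then F u v else 0" "\<lambda>v u. {v, u} \<in> edges G"]
    by (simp add: insert_commute)
  \<comment> \<open>After the exchange both summands agree up to bound names, so this bound replaces
    both and produces the factor 2.\<close>
  also have "(\<Sum>v\<in>verts G. \<Sum>u\<in>?N v. if R v u then F v u else 0) \<le> (\<Sum>v\<in>verts G. utility G s v)"
  proof (rule sum_mono)
    fix v assume v: "v \<in> verts G"
    have "(\<Sum>u\<in>?N v. if R v u then F v u else 0) = (\<Sum>u\<in>{u \<in> ?N v. R v u}. F v u)"
      using finite_neighbours[OF G] by (simp add: sum.inter_filter)
    also have "\<dots> \<le> utility G s v"
      unfolding F_def by (rule charged_reward_le_utility[OF G C N t v]) (auto simp: R_def)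
    finally show "(\<Sum>u\<in>?N v. if R v u then F v u else 0) \<le> utility G s v" .
  qed
  finally show ?thesis by (simp add: social_welfare_def)
qed

text \<open>A zero denominator forces \<open>a = 0\<close>; the ratio is then 1 by convention, which
  is where \<open>1 \<le> c\<close> enters.\<close>

lemma welfare_ratio_le:
  assumes "0 \<le> a" "0 \<le> b" "a \<le> c * b" "1 \<le> c"
  shows "welfare_ratio a b \<le> ereal c"
proof (cases "b = 0")
  case True
  then show ?thesis using assms by (simp add: welfare_ratio_def one_ereal_def)
next
  case False
  then show ?thesis using assms by (simp add: welfare_ratio_def divide_le_eq)
qed

theorem theorem3p1:
  shows "class_pairwise_price_of_anarchy
           {G :: 'v contribution_game. network_contribution_game G \<and> concave_rewards G} \<le> 2"
  unfolding class_pairwise_price_of_anarchy_def pairwise_price_of_anarchy_def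
proof (intro SUP_least Sup_least)
  fix G :: "'v contribution_game" and q
  assume "G \<in> {G \<in> {G. network_contribution_game G \<and> concave_rewards G}.
      \<exists>s. pairwise_equilibrium G s}"
  then have G: "network_contribution_game G" and C: "concave_rewards G" by auto
  assume "q \<in> {welfare_ratio (social_welfare G opt) (social_welfare G s) | opt s.
      social_optimum G opt \<and> pairwise_equilibrium G s}"
  then obtain t s where q: "q = welfare_ratio (social_welfare G t) (social_welfare G s)"
    and t: "t \<in> states G" and P: "pairwise_equilibrium G s"
    by (auto simp: social_optimum_def)
  have s: "s \<in> states G" using P by (simp add: pairwise_equilibrium_def nash_equilibrium_def)
  have "0 \<le> social_welfare G r" if "r \<in> states G" for r
    unfolding social_welfare_def using utility_nonneg[OF G that] by (intro sum_nonneg)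
  then have "q \<le> ereal 2"
    unfolding q using s t social_welfare_le_twice_equilibrium[OF G C P t]
    by (intro welfare_ratio_le) auto
  then show "q \<le> 2" by simp
qed

end
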